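(* Let $X$ be a real locally convex topological vector space, and let $A\subseteq X$ be a convex subset which is locally convex (as a subset) and locally compact, and which is complete as a uniform space with the uniformity induced from $X$. Let $A_0$ be a compact convex subset of $A$ and let $B\subseteq A$ be an open (in $A$) convex subset of $A$ such that $A_0\subseteq B$. Then there is a continuous function $f:A\to[0,1]$ with compact support such that $f(y)=1$ for every $y\in A_0$, $f(y)=0$ for every $y\in A\setminus B$, and $1-f$ is a quasi convex function on $A$.
   Context: Subsets $A$ of a topological vector space carry the subspace topology; open and closure are taken in $A$. The support of $f:A\to[0,1]$ is the closure in $A$ of $\{y\in A: f(y)\neq 0\}$. A subset $A$ of a topological vector space is said to be locally convex if every point of $A$ has a local base in $A$ consisting of convex subsets of $A$. The uniformity on $A$ is the one induced by a family $(p_i)_{i\in I}$ of seminorms defining the topology of $X$. A function $g:A\to\mathbb{R}$ on a convex subset $A$ of a real vector space is quasi convex if $\{x\in A: g(x)<r\}$ (equivalently, $\{x\in A: g(x)\le r\}$) is a convex set for every real number $r$. *)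

theory Defs
  imports "HOL-Analysis.Analysis"
begin

class real_topological_vector = real_vector + topological_ab_group_add +
  assumes tendsto_scaleR_Pair:
    "LIM z (nhds (c::real) \<times>\<^sub>F nhds x). fst z *\<^sub>R snd z :> nhds (c *\<^sub>R x)"

(* No separation axiom is assumed. Convexity of V is written out because the constant
   convex is not available inside a class specification. *)
class locally_convex_vector = real_topological_vector +
  assumes convex_local_base_0_unfolded:
    "open U \<Longrightarrow> 0 \<in> U \<Longrightarrow>
      \<exists>V. open V \<and> 0 \<in> V \<and> V \<subseteq> U \<and>
        (\<forall>x\<in>V. \<forall>y\<in>V. \<forall>u\<ge>0. \<forall>v\<ge>0. u + v = 1 \<longrightarrow> u *\<^sub>R x + v *\<^sub>R y \<in> V)"

lemma convex_local_base_0: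
  fixes U :: "'a::locally_convex_vector set"
  assumes "open U" "0 \<in> U"
  shows "\<exists>V. open V \<and> convex V \<and> 0 \<in> V \<and> V \<subseteq> U"
  using convex_local_base_0_unfolded[OF assms] unfolding convex_def by blast

definition seminorm :: "('a::real_vector \<Rightarrow> real) \<Rightarrow> bool" where
  "seminorm p \<longleftrightarrow>
    (\<forall>x y. p (x + y) \<le> p x + p y) \<and> (\<forall>c x. p (c *\<^sub>R x) = \<bar>c\<bar> * p x)"

(* Subbasic entourages {(x, y). p i (x - y) < e}; for empty I this is the trivial uniformity. *)
definition seminorm_uniformity :: "'i set \<Rightarrow> ('i \<Rightarrow> 'a::real_vector \<Rightarrow> real) \<Rightarrow> ('a \<times> 'a) filter"
  where
  "seminorm_uniformity I p =
    (INF i\<in>I. INF e\<in>{0<..}. principal {(x, y). p i (x - y) < e})"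

(* The class uniform_space already makes the topology the one of the uniformity, so
   the last conjunct also says that the family defines the topology. *)
definition defining_seminorms ::
  "'i set \<Rightarrow> ('i \<Rightarrow> 'a::{real_vector, uniform_space} \<Rightarrow> real) \<Rightarrow> bool" where
  "defining_seminorms I p \<longleftrightarrow>
    (\<forall>i\<in>I. seminorm (p i)) \<and> uniformity = seminorm_uniformity I p"

definition quasi_convex_on :: "'a::real_vector set \<Rightarrow> ('a \<Rightarrow> real) \<Rightarrow> bool" where
  "quasi_convex_on A g \<longleftrightarrow> convex A \<and> (\<forall>r. convex {x \<in> A. g x < r})"

(* The closure is taken in A, and the values of f outside A are irrelevant. *)
definition support_in :: "'a::topological_space set \<Rightarrow> ('a \<Rightarrow> real) \<Rightarrow> 'a set" where
  "support_in A f = top_of_set A closure_of {y \<in> A. f y \<noteq> 0}"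

end

theory Submission
  imports Defs
begin

text \<open>
  The function is a truncated distance to \<open>A\<^sub>0\<close>. By compactness there are one continuous
  seminorm \<open>q\<close>, a finite sum of members of the given family, and one \<open>\<epsilon> > 0\<close> such that every
  point of \<open>A\<close> at \<open>q\<close>-distance less than \<open>2 * \<epsilon>\<close> from \<open>A\<^sub>0\<close> lies in \<open>B\<close> and in a fixed compact
  subset of \<open>A\<close>: local compactness of \<open>A\<close> puts a compact neighbourhood around \<open>A\<^sub>0\<close>
  (\<open>compact_neighbourhood_of_compact\<close>), a compact set has a uniform neighbourhood inside any
  open set around it (\<open>compact_uniform_neighbourhood\<close>), and a single finite sum of seminorms
  controls any given entourage (\<open>seminorm_uniformity_basic\<close>).

  With \<open>d y = inf {q (y - a) | a \<in> A\<^sub>0}\<close>, put \<open>f y = max 0 (1 - d y / \<epsilon>)\<close>. The distance \<open>d\<close> is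
  1-Lipschitz for \<open>q\<close>, hence continuous, and its sublevel sets \<open>{d < r}\<close> are the convex sets
  \<open>A\<^sub>0 + {q < r}\<close>; therefore \<open>1 - f = min 1 (d / \<epsilon>)\<close> is quasi convex. The support of \<open>f\<close> lies
  in \<open>{d \<le> \<epsilon>}\<close>, a relatively closed subset of the compact set above. The case of empty \<open>A\<^sub>0\<close>,
  in which the infimum has no meaning, is settled by \<open>f = 0\<close>.
\<close>

section \<open>Seminorms and the uniformity they define\<close>

lemma seminorm_add: "seminorm p \<Longrightarrow> p (x + y) \<le> p x + p y"
  and seminorm_scaleR: "seminorm p \<Longrightarrow> p (c *\<^sub>R x) = \<bar>c\<bar> * p x"
  unfolding seminorm_def by blast+

lemma seminorm_zero: "seminorm p \<Longrightarrow> p 0 = 0"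
  using seminorm_scaleR[of p 0 0] by simp

lemma seminorm_minus: "seminorm p \<Longrightarrow> p (- x) = p x"
  using seminorm_scaleR[of p "-1" x] by simp

lemma seminorm_minus_commute: "seminorm p \<Longrightarrow> p (x - y) = p (y - x)"
  using seminorm_minus[of p "x - y"] by simp

lemma seminorm_nonneg: "seminorm p \<Longrightarrow> 0 \<le> p x"
  using seminorm_add[of p x "- x"] seminorm_zero[of p] seminorm_minus[of p x] by simp

lemma seminorm_triangle: "seminorm p \<Longrightarrow> p (x - z) \<le> p (x - y) + p (y - z)"
  using seminorm_add[of p "x - y" "y - z"] by simp

lemma seminorm_sum:
  assumes "\<And>i. i \<in> F \<Longrightarrow> seminorm (p i)"
  shows "seminorm (\<lambda>x. \<Sum>i\<in>F. p i x)"
  using assms unfolding seminorm_def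
  by (auto simp: sum_distrib_left sum.distrib[symmetric] intro: sum_mono)

text \<open>
  Finitely many subbasic entourages are all implied by smallness of the sum of the seminorms
  involved, because each summand is nonnegative.
\<close>

lemma seminorm_uniformity_basic:
  assumes "\<And>i. i \<in> I \<Longrightarrow> seminorm (p i)"
    and "eventually P (seminorm_uniformity I p)"
  obtains F e where "F \<subseteq> I" "finite F" "0 < e"
    "\<And>x y. (\<Sum>i\<in>F. p i (x - y)) < e \<Longrightarrow> P (x, y)"
proof -
  let ?S = "\<lambda>k. {(x, y). p (fst k) (x - y) < snd k}"
  have "seminorm_uniformity I p = (INF k\<in>I \<times> {0<..}. principal (?S k))"
    unfolding seminorm_uniformity_def INF_Sigma by (simp add: case_prod_beta)
  with assms(2) have "eventually P (INF k\<in>I \<times> {0<..}. principal (?S k))"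
    by simp
  then obtain X where X: "X \<subseteq> I \<times> {0<..}" "finite X"
      and "eventually P (INF k\<in>X. principal (?S k))"
    unfolding eventually_INF[of P _ "I \<times> {0<..}"] by blast
  then have P: "P z" if "z \<in> (\<Inter>k\<in>X. ?S k)" for z
    using that by (simp add: INF_principal_finite eventually_principal)
  define e where "e = Min (insert 1 (snd ` X))"
  show thesis
  proof
    show "fst ` X \<subseteq> I" "finite (fst ` X)"
      using X by auto
    show "0 < e"
      unfolding e_def using X by (subst Min_gr_iff) auto
    fix x y assume less: "(\<Sum>i\<in>fst ` X. p i (x - y)) < e"
    have "p (fst k) (x - y) < snd k" if "k \<in> X" for k
    proof -
      have "p (fst k) (x - y) \<le> (\<Sum>i\<in>fst ` X. p i (x - y))"
      proof (rule member_le_sum)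
        show "0 \<le> p i (x - y)" if "i \<in> fst ` X - {fst k}" for i
          using X that by (intro seminorm_nonneg assms(1)) auto
      qed (use X that in auto)
      moreover have "e \<le> snd k"
        unfolding e_def using X that by (intro Min_le) auto
      ultimately show ?thesis
        using less by linarith
    qed
    then show "P (x, y)"
      by (intro P) auto
  qed
qed

lemma eventually_seminorm_sum_less:
  assumes "finite F" "F \<subseteq> I" "0 < e"
  shows "eventually (\<lambda>(x, y). (\<Sum>i\<in>F. p i (x - y)) < e) (seminorm_uniformity I p)"
proof (cases "F = {}")
  case True
  with assms show ?thesis by (auto intro: always_eventually)
next
  case False
  define r where "r = e / card F"
  have r: "0 < r"
    unfolding r_def using assms False by (simp add: card_gt_0_iff)
  have "eventually (\<lambda>(x, y). p i (x - y) < r) (seminorm_uniformity I p)" if "i \<in> F" for i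
    unfolding seminorm_uniformity_def using that assms r
    by (intro eventually_INF1[of i] eventually_INF1[of r]) (auto simp: eventually_principal)
  then have "eventually (\<lambda>z. \<forall>i\<in>F. case z of (x, y) \<Rightarrow> p i (x - y) < r) (seminorm_uniformity I p)"
    using assms by (intro eventually_ball_finite) auto
  then show ?thesis
  proof (rule eventually_mono)
    fix z assume *: "\<forall>i\<in>F. case z of (x, y) \<Rightarrow> p i (x - y) < r"
    have "(\<Sum>i\<in>F. p i (fst z - snd z)) < (\<Sum>i\<in>F. r)"
      using * assms False by (intro sum_strict_mono) auto
    also have "\<dots> = e"
      unfolding r_def using assms False by simp
    finally show "case z of (x, y) \<Rightarrow> (\<Sum>i\<in>F. p i (x - y)) < e"
      by (simp add: case_prod_beta)
  qed
qed

section \<open>Neighbourhoods of compact sets\<close>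

text \<open>
  Each \<open>a \<in> K\<close> has an entourage \<open>D\<close> with \<open>D \<circ> D\<close> still leading from \<open>a\<close> into \<open>U\<close>; finitely many
  of the neighbourhoods cut out by the \<open>D\<close>s cover \<open>K\<close>, and the intersection of the finitely many
  \<open>D\<close>s is the required entourage.
\<close>

lemma compact_uniform_neighbourhood:
  fixes K U :: "'a::uniform_space set"
  assumes "compact K" "open U" "K \<subseteq> U"
  shows "eventually (\<lambda>(x, y). x \<in> K \<longrightarrow> y \<in> U) uniformity"
proof -
  have "\<exists>D S. eventually D uniformity \<and> open S \<and> a \<in> S \<and>
      (\<forall>x\<in>S. \<forall>y. D (x, y) \<longrightarrow> y \<in> U)" if "a \<in> K" for a
  proof -
    have "eventually (\<lambda>y. y \<in> U) (nhds a)"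
      using assms that by (auto intro: eventually_nhds_in_open)
    then have "eventually (\<lambda>(x, y). x = a \<longrightarrow> y \<in> U) uniformity"
      unfolding eventually_nhds_uniformity .
    then obtain D where D: "eventually D uniformity"
      "\<And>x y z. D (x, y) \<Longrightarrow> D (y, z) \<Longrightarrow> x = a \<longrightarrow> z \<in> U"
      by (rule uniformity_transE) auto
    have "eventually (\<lambda>y. D (a, y)) (nhds a)"
      unfolding eventually_nhds_uniformity using D(1) by (rule eventually_mono) auto
    then obtain S where "open S" "a \<in> S" "\<forall>x\<in>S. D (a, x)"
      unfolding eventually_nhds by blast
    with D show ?thesis by blast
  qed
  then obtain D S where DS: "\<And>a. a \<in> K \<Longrightarrow> eventually (D a) uniformity"
      "\<And>a. a \<in> K \<Longrightarrow> open (S a)" "\<And>a. a \<in> K \<Longrightarrow> a \<in> S a"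
      "\<And>a x y. a \<in> K \<Longrightarrow> x \<in> S a \<Longrightarrow> D a (x, y) \<Longrightarrow> y \<in> U"
    by metis
  have "K \<subseteq> (\<Union>a\<in>K. S a)"
    using DS(3) by blast
  then obtain K' where K': "K' \<subseteq> K" "finite K'" "K \<subseteq> (\<Union>a\<in>K'. S a)"
    using compactE_image[of K K S] assms(1) DS(2) by metis
  have "eventually (\<lambda>z. \<forall>a\<in>K'. D a z) uniformity"
    using K' DS(1) by (intro eventually_ball_finite) auto
  then show ?thesis
  proof (rule eventually_mono)
    fix z assume z: "\<forall>a\<in>K'. D a z"
    have "y \<in> U" if "z = (x, y)" "x \<in> K" for x y
      using K' DS(4) z that by blast
    then show "case z of (x, y) \<Rightarrow> x \<in> K \<longrightarrow> y \<in> U"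
      by auto
  qed
qed

lemma compact_neighbourhood_of_compact:
  assumes "locally_compact_space (top_of_set A)" "compact K" "K \<subseteq> A"
  obtains U C where "open U" "K \<subseteq> U" "A \<inter> U \<subseteq> C" "C \<subseteq> A" "compact C"
proof -
  have "\<exists>U C. open U \<and> a \<in> U \<and> A \<inter> U \<subseteq> C \<and> C \<subseteq> A \<and> compact C" if "a \<in> K" for a
  proof -
    from that assms(3) have "a \<in> A" by blast
    with assms(1) obtain V C where "openin (top_of_set A) V" "compactin (top_of_set A) C"
        "a \<in> V" "V \<subseteq> C"
      unfolding locally_compact_space_def by auto
    then show ?thesis
      by (auto simp: openin_open compactin_subtopology)
  qed
  then obtain U C where UC: "\<And>a. a \<in> K \<Longrightarrow> open (U a)" "\<And>a. a \<in> K \<Longrightarrow> a \<in> U a"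
      "\<And>a. a \<in> K \<Longrightarrow> A \<inter> U a \<subseteq> C a" "\<And>a. a \<in> K \<Longrightarrow> C a \<subseteq> A" "\<And>a. a \<in> K \<Longrightarrow> compact (C a)"
    by metis
  have "K \<subseteq> (\<Union>a\<in>K. U a)"
    using UC(2) by blast
  then obtain K' where K': "K' \<subseteq> K" "finite K'" "K \<subseteq> (\<Union>a\<in>K'. U a)"
    using compactE_image[of K K U] assms(2) UC(1) by metis
  show thesis
  proof
    show "open (\<Union>a\<in>K'. U a)" "K \<subseteq> (\<Union>a\<in>K'. U a)"
      using K' UC(1) by auto
    show "A \<inter> (\<Union>a\<in>K'. U a) \<subseteq> (\<Union>a\<in>K'. C a)" "(\<Union>a\<in>K'. C a) \<subseteq> A"
      using K'(1) UC(3,4) by blast+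
    show "compact (\<Union>a\<in>K'. C a)"
      using K' UC(5) by (intro compact_UN) auto
  qed
qed

section \<open>The distance to a set with respect to a seminorm\<close>

definition seminorm_dist :: "('a::real_vector \<Rightarrow> real) \<Rightarrow> 'a set \<Rightarrow> 'a \<Rightarrow> real" where
  "seminorm_dist q K y = (INF a\<in>K. q (y - a))"

lemma seminorm_dist_bdd_below:
  assumes "seminorm q"
  shows "bdd_below ((\<lambda>a. q (y - a)) ` K)"
  using seminorm_nonneg[OF assms] by (intro bdd_belowI[of _ 0]) auto

lemma seminorm_dist_less_iff:
  assumes "seminorm q" "K \<noteq> {}"
  shows "seminorm_dist q K y < r \<longleftrightarrow> (\<exists>a\<in>K. q (y - a) < r)"
  unfolding seminorm_dist_def
  using cINF_less_iff[OF assms(2) seminorm_dist_bdd_below[OF assms(1)]] .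

lemma seminorm_dist_nonneg:
  assumes "seminorm q" "K \<noteq> {}"
  shows "0 \<le> seminorm_dist q K y"
  using seminorm_dist_less_iff[OF assms, of y 0] seminorm_nonneg[OF assms(1)]
  by (meson not_less)

lemma seminorm_dist_eq_0:
  assumes "seminorm q" "y \<in> K"
  shows "seminorm_dist q K y = 0"
proof -
  have "seminorm_dist q K y \<le> q (y - y)"
    unfolding seminorm_dist_def using assms by (intro cINF_lower seminorm_dist_bdd_below)
  moreover have "0 \<le> seminorm_dist q K y"
    using assms by (intro seminorm_dist_nonneg) auto
  ultimately show ?thesis
    using seminorm_zero[OF assms(1)] by simp
qed

lemma seminorm_dist_le:
  assumes "seminorm q" "K \<noteq> {}"
  shows "seminorm_dist q K y \<le> q (y - z) + seminorm_dist q K z"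
proof -
  have "seminorm_dist q K y - q (y - z) \<le> q (z - a)" if "a \<in> K" for a
  proof -
    have "seminorm_dist q K y \<le> q (y - a)"
      unfolding seminorm_dist_def using assms that by (intro cINF_lower seminorm_dist_bdd_below)
    also have "\<dots> \<le> q (y - z) + q (z - a)"
      using assms(1) by (rule seminorm_triangle)
    finally show ?thesis by simp
  qed
  then have "seminorm_dist q K y - q (y - z) \<le> seminorm_dist q K z"
    unfolding seminorm_dist_def[of q K z] using assms(2) by (intro cINF_greatest)
  then show ?thesis by simp
qed

lemma seminorm_dist_Lipschitz:
  assumes "seminorm q" "K \<noteq> {}"
  shows "\<bar>seminorm_dist q K y - seminorm_dist q K z\<bar> \<le> q (y - z)"
  using seminorm_dist_le[OF assms, of y z] seminorm_dist_le[OF assms, of z y]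
    seminorm_minus_commute[OF assms(1), of y z]
  by linarith

lemma continuous_on_seminorm_dist:
  fixes q :: "'a::{real_vector, uniform_space} \<Rightarrow> real"
  assumes "seminorm q" "K \<noteq> {}"
    and "\<And>e. 0 < e \<Longrightarrow> eventually (\<lambda>(x, y). q (x - y) < e) uniformity"
  shows "continuous_on A (seminorm_dist q K)"
proof (rule uniformly_continuous_imp_continuous)
  show "uniformly_continuous_on A (seminorm_dist q K)"
    unfolding uniformly_continuous_on_uniformity filterlim_iff
  proof (intro allI impI)
    fix P :: "real \<times> real \<Rightarrow> bool"
    assume "eventually P uniformity"
    then obtain e where e: "0 < e" "\<And>s t. dist s t < e \<Longrightarrow> P (s, t)"
      unfolding eventually_uniformity_metric by blast
    have "P (seminorm_dist q K x, seminorm_dist q K y)" if "q (x - y) < e" for x y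
      using e(2) seminorm_dist_Lipschitz[OF assms(1,2), of x y] that
      by (simp add: dist_real_def)
    then have "eventually (\<lambda>(x, y). P (seminorm_dist q K x, seminorm_dist q K y)) uniformity"
      using assms(3)[OF e(1)] by (auto elim: eventually_mono)
    then show "eventually (\<lambda>z. P (case z of (x, y) \<Rightarrow> (seminorm_dist q K x, seminorm_dist q K y)))
        (uniformity_on A)"
      unfolding eventually_inf_principal by (rule eventually_mono) auto
  qed
qed

lemma convex_seminorm_dist_less:
  assumes "seminorm q" "K \<noteq> {}" "convex K"
  shows "convex {y. seminorm_dist q K y < r}"
proof (rule convexI)
  fix x y :: 'a and u v :: real
  assume uv: "0 \<le> u" "0 \<le> v" "u + v = 1"
    and "x \<in> {y. seminorm_dist q K y < r}" "y \<in> {y. seminorm_dist q K y < r}"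
  then obtain a b where ab: "a \<in> K" "q (x - a) < r" "b \<in> K" "q (y - b) < r"
    using seminorm_dist_less_iff[OF assms(1,2)] by auto
  have "q ((u *\<^sub>R x + v *\<^sub>R y) - (u *\<^sub>R a + v *\<^sub>R b)) = q (u *\<^sub>R (x - a) + v *\<^sub>R (y - b))"
    by (simp add: algebra_simps)
  also have "\<dots> \<le> u * q (x - a) + v * q (y - b)"
    using seminorm_add[OF assms(1)] seminorm_scaleR[OF assms(1)] uv
    by (metis abs_of_nonneg)
  also have "\<dots> < r"
    using uv ab by (intro convex_bound_lt)
  finally have "q ((u *\<^sub>R x + v *\<^sub>R y) - (u *\<^sub>R a + v *\<^sub>R b)) < r" .
  moreover have "u *\<^sub>R a + v *\<^sub>R b \<in> K"
    using assms(3) ab uv by (intro convexD)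
  ultimately show "u *\<^sub>R x + v *\<^sub>R y \<in> {y. seminorm_dist q K y < r}"
    using seminorm_dist_less_iff[OF assms(1,2)] by auto
qed

section \<open>The separating function\<close>

theorem mainTheorem2:
  fixes A A\<^sub>0 B :: "'a::{locally_convex_vector, uniform_space} set"
    and I :: "'i set"
    and p :: "'i \<Rightarrow> 'a \<Rightarrow> real"
  assumes "defining_seminorms I p"
    and "convex A"
    and "locally convex A"
    and "locally_compact_space (top_of_set A)"
    and "complete A"
    and "A\<^sub>0 \<subseteq> A" and "compact A\<^sub>0" and "convex A\<^sub>0"
    and "openin (top_of_set A) B" and "convex B"
    and "A\<^sub>0 \<subseteq> B"
  shows "\<exists>f :: 'a \<Rightarrow> real.
    continuous_on A f \<and> f ` A \<subseteq> {0..1} \<and>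
    compact (support_in A f) \<and>
    (\<forall>y\<in>A\<^sub>0. f y = 1) \<and>
    (\<forall>y\<in>A - B. f y = 0) \<and>
    quasi_convex_on A (\<lambda>y. 1 - f y)"
proof (cases "A\<^sub>0 = {}")
  case True
  have "convex {y \<in> A. 1 < r}" for r :: real
    using \<open>convex A\<close> by (cases "1 < r") auto
  with True \<open>convex A\<close> show ?thesis
    by (intro exI[of _ "\<lambda>_. 0"]) (auto simp: support_in_def quasi_convex_on_def)
next
  case False
  have p: "\<And>i. i \<in> I \<Longrightarrow> seminorm (p i)"
    and unif: "uniformity = seminorm_uniformity I p"
    using assms(1) unfolding defining_seminorms_def by blast+
  obtain U C where U: "open U" "A\<^sub>0 \<subseteq> U" "A \<inter> U \<subseteq> C" and C: "C \<subseteq> A" "compact C"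
    using compact_neighbourhood_of_compact[OF assms(4,7,6)] .
  obtain V where V: "open V" "B = A \<inter> V"
    using assms(9) unfolding openin_open by blast
  have "eventually (\<lambda>(x, y). x \<in> A\<^sub>0 \<longrightarrow> y \<in> U \<inter> V) uniformity"
    using assms(7,11) U V by (intro compact_uniform_neighbourhood) auto
  then obtain F e where F: "F \<subseteq> I" "finite F" and "0 < e"
      and near: "\<And>x y. (\<Sum>i\<in>F. p i (x - y)) < e \<Longrightarrow> x \<in> A\<^sub>0 \<longrightarrow> y \<in> U \<inter> V"
    unfolding unif by (rule seminorm_uniformity_basic[OF p, rotated]) auto
  define q where "q = (\<lambda>x. \<Sum>i\<in>F. p i x)"
  have q: "seminorm q"
    unfolding q_def using F p by (intro seminorm_sum) auto
  define d where "d = seminorm_dist q A\<^sub>0"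
  have d_nonneg: "0 \<le> d y" for y
    unfolding d_def using q False by (rule seminorm_dist_nonneg)
  have d_near: "y \<in> U \<inter> V" if "d y < e" for y
  proof -
    have "\<exists>a\<in>A\<^sub>0. q (a - y) < e"
      using that seminorm_dist_less_iff[OF q False] seminorm_minus_commute[OF q]
      unfolding d_def by metis
    then show ?thesis
      using near unfolding q_def by blast
  qed
  have d_cont: "continuous_on A d"
    unfolding d_def
    using q False eventually_seminorm_sum_less[OF F(2,1), of _ p]
    by (intro continuous_on_seminorm_dist) (simp_all add: q_def unif)
  \<comment> \<open>Halving \<open>e\<close> leaves room for the closure of \<open>{d < \<epsilon>}\<close>.\<close>
  define \<epsilon> where "\<epsilon> = e / 2"
  have \<epsilon>: "0 < \<epsilon>" "\<epsilon> < e"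
    unfolding \<epsilon>_def using \<open>0 < e\<close> by auto
  define f where "f = (\<lambda>y. max 0 (1 - d y / \<epsilon>))"
  have f_nonzero: "f y \<noteq> 0 \<longleftrightarrow> d y < \<epsilon>" for y
    unfolding f_def using \<epsilon> by (auto simp: max_def field_simps)
  have support: "compact (support_in A f)"
  proof -
    have "closedin (top_of_set A) {y \<in> A. d y \<le> \<epsilon>}"
      using continuous_closedin_preimage[OF d_cont closed_atMost[of \<epsilon>]]
      by (simp add: vimage_def Int_def)
    then have "support_in A f \<subseteq> {y \<in> A. d y \<le> \<epsilon>}"
      unfolding support_in_def f_nonzero by (intro closure_of_minimal) auto
    also have "\<dots> \<subseteq> C"
      using d_near \<epsilon> U(3) by force
    finally have "support_in A f \<subseteq> C" .
    moreover have "closedin (top_of_set A) (support_in A f)"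
      unfolding support_in_def by simp
    then obtain T where "closed T" "support_in A f = A \<inter> T"
      unfolding closedin_closed by blast
    ultimately have "support_in A f = C \<inter> T"
      using C(1) by blast
    then show ?thesis
      using C(2) \<open>closed T\<close> by (simp add: compact_Int_closed)
  qed
  have quasi_convex: "quasi_convex_on A (\<lambda>y. 1 - f y)"
    unfolding quasi_convex_on_def
  proof (intro conjI allI)
    show "convex {y \<in> A. 1 - f y < r}" for r
    proof (cases "1 < r")
      case True
      then have "{y \<in> A. 1 - f y < r} = A"
        by (auto simp: f_def)
      with \<open>convex A\<close> show ?thesis by simp
    next
      case False
      have "1 - f y < r \<longleftrightarrow> d y / \<epsilon> < r" for y
        using False by (auto simp: f_def)
      then have "{y \<in> A. 1 - f y < r} = A \<inter> {y. d y < r * \<epsilon>}"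
        using \<epsilon> by (auto simp: pos_divide_less_eq)
      moreover have "convex {y. d y < r * \<epsilon>}"
        unfolding d_def using q \<open>A\<^sub>0 \<noteq> {}\<close> \<open>convex A\<^sub>0\<close> by (rule convex_seminorm_dist_less)
      ultimately show ?thesis
        using \<open>convex A\<close> by (simp add: convex_Int)
    qed
  qed (rule \<open>convex A\<close>)
  show ?thesis
  proof (intro exI[of _ f] conjI ballI)
    show "continuous_on A f"
      unfolding f_def using \<epsilon> by (intro continuous_intros d_cont) auto
    show "f ` A \<subseteq> {0..1}"
      unfolding f_def using d_nonneg \<epsilon> by auto
    show "f y = 1" if "y \<in> A\<^sub>0" for y
      using seminorm_dist_eq_0[OF q that] by (simp add: f_def d_def)
    show "f y = 0" if "y \<in> A - B" for y
      using that d_near f_nonzero \<epsilon> V(2) by force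
  qed (fact support quasi_convex)+
qed

end
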